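(* Problem $(\mathrm{MAX}uvwt)$ is equivalent to the following semidefinite program $(\mathrm{SDP}_a)$, in the sense that the two problems have the same optimal value and $(u,v,w,t)$ is optimal for $(\mathrm{MAX}uvwt)$ if and only if it is the $(u,v,w,t)$-part of an optimal solution of $(\mathrm{SDP}_a)$: $$\max\ \tau\quad\text{s.t.}\quad \begin{pmatrix}P_{11}&P_{12}&P_{13}&P_{14}\\P_{12}^T&P_{22}&P_{23}&P_{24}\\P_{13}^T&P_{23}^T&P_{33}&P_{34}\\P_{14}^T&P_{24}^T&P_{34}^T&P_{44}\end{pmatrix}\succeq0,$$ over $(\delta,\mu,\sigma,\lambda,\pi)\in\mathbb{R}^m_+\times\mathbb{R}^n_+\times\mathbb{R}^n_+\times\mathbb{R}^n_+\times\mathbb{R}^n_+$ and $(\eta,\zeta,u,v,w,t,\tau)\in\mathbb{R}^m\times\mathbb{R}^M\times\mathbb{R}^n\times\mathbb{R}^n\times\mathbb{R}^M\times\mathbb{R}^m\times\mathbb{R}$, where $P_{11}=Q+E^T\mathrm{diag}(w)E+A^T\mathrm{diag}(t)A$, $P_{12}=\tfrac12\mathrm{diag}(u)+E^T\mathrm{diag}(w)F+A^T\mathrm{diag}(t)B$, $P_{13}=A^T\mathrm{diag}(t)$, $P_{14}=\tfrac12\big(c-u+A^T\eta+E^T\zeta-2E^T\mathrm{diag}(w)g-2A^T\mathrm{diag}(t)d-\mu+\sigma\big)$, $P_{22}=\mathrm{diag}(v)+F^T\mathrm{diag}(w)F+B^T\mathrm{diag}(t)B$, $P_{23}=B^T\mathrm{diag}(t)$,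 $P_{24}=\tfrac12\big(h-v+B^T\eta+F^T\zeta-2F^T\mathrm{diag}(w)g-2B^T\mathrm{diag}(t)d+\mathrm{diag}(a)\mu-\mathrm{diag}(b)\sigma-\lambda+\pi\big)$, $P_{33}=\mathrm{diag}(t)$, $P_{34}=\tfrac12\big(\eta-\delta-2\,\mathrm{diag}(t)d\big)$, $P_{44}=-\eta^Td-e^T\pi-\zeta^Tg+g^T\mathrm{diag}(w)g+d^T\mathrm{diag}(t)d-\tau$.
   Context: Data and standing assumptions: $Q$ is a symmetric positive semidefinite $n\times n$ real matrix, $c,h\in\mathbb{R}^n$, $d\in\mathbb{R}^m$, $A,B\in\mathbb{R}^{m\times n}$, $g\in\mathbb{R}^M$, $E,F\in\mathbb{R}^{M\times n}$, and $a,b\in\mathbb{R}^n$ with $a_i<b_i$ for all $i=1,\dots,n$. The mixed-integer problem $(\mathrm{P}')$: minimize $x^TQx+c^Tx+h^Ty$ subject to $Ax+By\le d$, $Ex+Fy=g$, $a_iy_i\le x_i\le b_iy_i$, $y_i\in\{0,1\}$ ($i=1,\dots,n$), is assumed to have a nonempty feasible set. $v(\cdot)$ denotes the optimal value of a problem; $\mathrm{diag}(r)$ is the diagonal matrix with diagonal $r$; $e$ is the all-one vector; $\succeq 0$ means positive semidefinite. For $u,v\in\mathbb{R}^n$, $w\in\mathbb{R}^M$, $t\in\mathbb{R}^m$, define for $(x,y,s)\in\mathbb{R}^n\times\mathbb{R}^n\times\mathbb{R}^m$ $$\begin{aligned}f_{u,v,w,t}(x,y,s)=\;&x^TQx+c^Tx+h^Ty+\sum_{i=1}^n(u_ix_iy_i+v_iy_i^2-u_ix_i-v_iy_i)\\&+(Ex+Fy-g)^T\mathrm{diag}(w)(Ex+Fy-g)\\&+(Ax+By+s-d)^T\mathrm{diag}(t)(Ax+By+s-d).\end{aligned}$$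 Problem $(\overline{\mathrm{P}}(u,v,w,t))$ is: minimize $f_{u,v,w,t}(x,y,s)$ subject to $Ax+By+s=d$, $s\ge0$, $Ex+Fy=g$, $a_iy_i\le x_i\le b_iy_i$, $y_i\in[0,1]$ ($i=1,\dots,n$). Problem $(\mathrm{MAX}uvwt)$ is: maximize $v(\overline{\mathrm{P}}(u,v,w,t))$ over all $(u,v,w,t)\in\mathbb{R}^n\times\mathbb{R}^n\times\mathbb{R}^M\times\mathbb{R}^m$ such that $f_{u,v,w,t}$ is convex on $\mathbb{R}^n\times\mathbb{R}^n\times\mathbb{R}^m$. *)

theory Defs
  imports "HOL-Analysis.Analysis"
begin

definition diag :: "real^'n \<Rightarrow> real^'n^'n" where
  "diag r = (\<chi> i j. if i = j then r $ i else 0)"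

definition psd :: "real^'n^'n \<Rightarrow> bool" where
  "psd X \<longleftrightarrow> transpose X = X \<and> (\<forall>z. 0 \<le> z \<bullet> (X *v z))"

text \<open>
  Optimal values are extended reals: an infeasible minimization problem has value \<open>\<infinity>\<close>,
  an infeasible maximization problem has value \<open>-\<infinity>\<close>.
\<close>

definition min_value :: "('a \<Rightarrow> ereal) \<Rightarrow> 'a set \<Rightarrow> ereal" where
  "min_value \<phi> S = (INF x\<in>S. \<phi> x)"

definition max_value :: "('a \<Rightarrow> ereal) \<Rightarrow> 'a set \<Rightarrow> ereal" where
  "max_value \<phi> S = (SUP x\<in>S. \<phi> x)"

definition max_solution :: "('a \<Rightarrow> ereal) \<Rightarrow> 'a set \<Rightarrow> 'a \<Rightarrow> bool" where
  "max_solution \<phi> S x \<longleftrightarrow> is_arg_max \<phi> (\<lambda>y. y \<in> S) x"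

text \<open>
  Entries of the symmetric \<open>4 \<times> 4\<close> block matrix with the given upper triangle. Rows and columns are
  indexed by \<open>'n + 'p + 'm + unit\<close>, so the blocks of the last column are vectors and the
  bottom right block is a number.
\<close>

fun sym_block4_entry ::
  "real^'n^'n \<Rightarrow> real^'p^'n \<Rightarrow> real^'m^'n \<Rightarrow> real^'n \<Rightarrow>
   real^'p^'p \<Rightarrow> real^'m^'p \<Rightarrow> real^'p \<Rightarrow>
   real^'m^'m \<Rightarrow> real^'m \<Rightarrow> real \<Rightarrow>
   'n + 'p + 'm + unit \<Rightarrow> 'n + 'p + 'm + unit \<Rightarrow> real" where
  "sym_block4_entry P11 P12 P13 P14 P22 P23 P24 P33 P34 P44 (Inl i) (Inl j) = P11 $ i $ j"
| "sym_block4_entry P11 P12 P13 P14 P22 P23 P24 P33 P34 P44 (Inl i) (Inr (Inl j)) = P12 $ i $ j"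
| "sym_block4_entry P11 P12 P13 P14 P22 P23 P24 P33 P34 P44 (Inl i) (Inr (Inr (Inl j))) = P13 $ i $ j"
| "sym_block4_entry P11 P12 P13 P14 P22 P23 P24 P33 P34 P44 (Inl i) (Inr (Inr (Inr _))) = P14 $ i"
| "sym_block4_entry P11 P12 P13 P14 P22 P23 P24 P33 P34 P44 (Inr (Inl i)) (Inl j) = transpose P12 $ i $ j"
| "sym_block4_entry P11 P12 P13 P14 P22 P23 P24 P33 P34 P44 (Inr (Inl i)) (Inr (Inl j)) = P22 $ i $ j"
| "sym_block4_entry P11 P12 P13 P14 P22 P23 P24 P33 P34 P44 (Inr (Inl i)) (Inr (Inr (Inl j))) = P23 $ i $ j"
| "sym_block4_entry P11 P12 P13 P14 P22 P23 P24 P33 P34 P44 (Inr (Inl i)) (Inr (Inr (Inr _))) = P24 $ i"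
| "sym_block4_entry P11 P12 P13 P14 P22 P23 P24 P33 P34 P44 (Inr (Inr (Inl i))) (Inl j) = transpose P13 $ i $ j"
| "sym_block4_entry P11 P12 P13 P14 P22 P23 P24 P33 P34 P44 (Inr (Inr (Inl i))) (Inr (Inl j)) = transpose P23 $ i $ j"
| "sym_block4_entry P11 P12 P13 P14 P22 P23 P24 P33 P34 P44 (Inr (Inr (Inl i))) (Inr (Inr (Inl j))) = P33 $ i $ j"
| "sym_block4_entry P11 P12 P13 P14 P22 P23 P24 P33 P34 P44 (Inr (Inr (Inl i))) (Inr (Inr (Inr _))) = P34 $ i"
| "sym_block4_entry P11 P12 P13 P14 P22 P23 P24 P33 P34 P44 (Inr (Inr (Inr _))) (Inl j) = P14 $ j"
| "sym_block4_entry P11 P12 P13 P14 P22 P23 P24 P33 P34 P44 (Inr (Inr (Inr _))) (Inr (Inl j)) = P24 $ j"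
| "sym_block4_entry P11 P12 P13 P14 P22 P23 P24 P33 P34 P44 (Inr (Inr (Inr _))) (Inr (Inr (Inl j))) = P34 $ j"
| "sym_block4_entry P11 P12 P13 P14 P22 P23 P24 P33 P34 P44 (Inr (Inr (Inr _))) (Inr (Inr (Inr _))) = P44"

definition sym_block4 ::
  "real^'n^'n \<Rightarrow> real^'p^'n \<Rightarrow> real^'m^'n \<Rightarrow> real^'n \<Rightarrow>
   real^'p^'p \<Rightarrow> real^'m^'p \<Rightarrow> real^'p \<Rightarrow>
   real^'m^'m \<Rightarrow> real^'m \<Rightarrow> real \<Rightarrow>
   real^('n + 'p + 'm + unit)^('n + 'p + 'm + unit)" where
  "sym_block4 P11 P12 P13 P14 P22 P23 P24 P33 P34 P44 =
     (\<chi> i j. sym_block4_entry P11 P12 P13 P14 P22 P23 P24 P33 P34 P44 i j)"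

text \<open>
  The locale only collects the data; the type \<open>'k\<close> indexes the \<open>M\<close> equality constraints.
\<close>

locale mixed_binary_qp =
  fixes Q :: "real^'n^'n"
    and c h :: "real^'n"
    and d :: "real^'m"
    and A B :: "real^'n^'m"
    and g :: "real^'k"
    and E F :: "real^'n^'k"
    and a b :: "real^'n"
begin

definition mip_feasible :: "((real^'n) \<times> (real^'n)) set" where
  "mip_feasible = {(x, y).
     A *v x + B *v y \<le> d \<and> E *v x + F *v y = g \<and>
     (\<forall>i. a $ i * y $ i \<le> x $ i \<and> x $ i \<le> b $ i * y $ i \<and> y $ i \<in> {0, 1})}"

definition f :: "real^'n \<Rightarrow> real^'n \<Rightarrow> real^'k \<Rightarrow> real^'m \<Rightarrow>
    (real^'n) \<times> (real^'n) \<times> (real^'m) \<Rightarrow> real" where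
  "f u v w t = (\<lambda>(x, y, s).
     x \<bullet> (Q *v x) + c \<bullet> x + h \<bullet> y
     + (\<Sum>i\<in>UNIV. u $ i * x $ i * y $ i + v $ i * (y $ i)\<^sup>2 - u $ i * x $ i - v $ i * y $ i)
     + (E *v x + F *v y - g) \<bullet> (diag w *v (E *v x + F *v y - g))
     + (A *v x + B *v y + s - d) \<bullet> (diag t *v (A *v x + B *v y + s - d)))"

definition relax_feasible :: "((real^'n) \<times> (real^'n) \<times> (real^'m)) set" where
  "relax_feasible = {(x, y, s).
     A *v x + B *v y + s = d \<and> 0 \<le> s \<and> E *v x + F *v y = g \<and>
     (\<forall>i. a $ i * y $ i \<le> x $ i \<and> x $ i \<le> b $ i * y $ i \<and> y $ i \<in> {0..1})}"

definition relax_value :: "(real^'n) \<times> (real^'n) \<times> (real^'k) \<times> (real^'m) \<Rightarrow> ereal" where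
  "relax_value = (\<lambda>(u, v, w, t). min_value (\<lambda>z. ereal (f u v w t z)) relax_feasible)"

definition MAX_feasible :: "((real^'n) \<times> (real^'n) \<times> (real^'k) \<times> (real^'m)) set" where
  "MAX_feasible = {(u, v, w, t). convex_on UNIV (f u v w t)}"

definition P11 :: "real^'k \<Rightarrow> real^'m \<Rightarrow> real^'n^'n" where
  "P11 w t = Q + transpose E ** diag w ** E + transpose A ** diag t ** A"

definition P12 :: "real^'n \<Rightarrow> real^'k \<Rightarrow> real^'m \<Rightarrow> real^'n^'n" where
  "P12 u w t = (1/2) *\<^sub>R diag u + transpose E ** diag w ** F + transpose A ** diag t ** B"

definition P13 :: "real^'m \<Rightarrow> real^'m^'n" where
  "P13 t = transpose A ** diag t"

definition P14 :: "real^'n \<Rightarrow> real^'n \<Rightarrow> real^'m \<Rightarrow> real^'k \<Rightarrow>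
    real^'n \<Rightarrow> real^'k \<Rightarrow> real^'m \<Rightarrow> real^'n" where
  "P14 \<mu> \<sigma> \<eta> \<zeta> u w t = (1/2) *\<^sub>R
     (c - u + transpose A *v \<eta> + transpose E *v \<zeta>
      - 2 *\<^sub>R ((transpose E ** diag w) *v g) - 2 *\<^sub>R ((transpose A ** diag t) *v d) - \<mu> + \<sigma>)"

definition P22 :: "real^'n \<Rightarrow> real^'k \<Rightarrow> real^'m \<Rightarrow> real^'n^'n" where
  "P22 v w t = diag v + transpose F ** diag w ** F + transpose B ** diag t ** B"

definition P23 :: "real^'m \<Rightarrow> real^'m^'n" where
  "P23 t = transpose B ** diag t"

definition P24 :: "real^'n \<Rightarrow> real^'n \<Rightarrow> real^'n \<Rightarrow> real^'n \<Rightarrow> real^'m \<Rightarrow> real^'k \<Rightarrow>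
    real^'n \<Rightarrow> real^'k \<Rightarrow> real^'m \<Rightarrow> real^'n" where
  "P24 \<mu> \<sigma> \<nu> \<pi> \<eta> \<zeta> v w t = (1/2) *\<^sub>R
     (h - v + transpose B *v \<eta> + transpose F *v \<zeta>
      - 2 *\<^sub>R ((transpose F ** diag w) *v g) - 2 *\<^sub>R ((transpose B ** diag t) *v d)
      + diag a *v \<mu> - diag b *v \<sigma> - \<nu> + \<pi>)"

definition P33 :: "real^'m \<Rightarrow> real^'m^'m" where
  "P33 t = diag t"

definition P34 :: "real^'m \<Rightarrow> real^'m \<Rightarrow> real^'m \<Rightarrow> real^'m" where
  "P34 \<delta> \<eta> t = (1/2) *\<^sub>R (\<eta> - \<delta> - 2 *\<^sub>R (diag t *v d))"

definition P44 :: "real^'n \<Rightarrow> real^'m \<Rightarrow> real^'k \<Rightarrow> real^'k \<Rightarrow> real^'m \<Rightarrow> real \<Rightarrow> real" where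
  "P44 \<pi> \<eta> \<zeta> w t \<tau> =
     - (\<eta> \<bullet> d) - vec 1 \<bullet> \<pi> - \<zeta> \<bullet> g + g \<bullet> (diag w *v g) + d \<bullet> (diag t *v d) - \<tau>"

text \<open>
  The variables of the semidefinite program are
  \<open>((\<delta>, \<mu>, \<sigma>, \<nu>, \<pi>), (\<eta>, \<zeta>, u, v, w, t, \<tau>))\<close>; here \<open>\<nu>\<close> is the multiplier of \<open>y \<ge> 0\<close>
  usually called lambda.
\<close>

definition SDP_feasible ::
  "(((real^'m) \<times> (real^'n) \<times> (real^'n) \<times> (real^'n) \<times> (real^'n)) \<times>
    ((real^'m) \<times> (real^'k) \<times> (real^'n) \<times> (real^'n) \<times> (real^'k) \<times> (real^'m) \<times> real)) set" where
  "SDP_feasible = {((\<delta>, \<mu>, \<sigma>, \<nu>, \<pi>), (\<eta>, \<zeta>, u, v, w, t, \<tau>)).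
     0 \<le> \<delta> \<and> 0 \<le> \<mu> \<and> 0 \<le> \<sigma> \<and> 0 \<le> \<nu> \<and> 0 \<le> \<pi> \<and>
     psd (sym_block4
       (P11 w t) (P12 u w t) (P13 t) (P14 \<mu> \<sigma> \<eta> \<zeta> u w t)
                 (P22 v w t) (P23 t) (P24 \<mu> \<sigma> \<nu> \<pi> \<eta> \<zeta> v w t)
                             (P33 t) (P34 \<delta> \<eta> t)
                                     (P44 \<pi> \<eta> \<zeta> w t \<tau>))}"

definition SDP_objective ::
  "((real^'m) \<times> (real^'n) \<times> (real^'n) \<times> (real^'n) \<times> (real^'n)) \<times>
   ((real^'m) \<times> (real^'k) \<times> (real^'n) \<times> (real^'n) \<times> (real^'k) \<times> (real^'m) \<times> real) \<Rightarrow> ereal" where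
  "SDP_objective = (\<lambda>((\<delta>, \<mu>, \<sigma>, \<nu>, \<pi>), (\<eta>, \<zeta>, u, v, w, t, \<tau>)). ereal \<tau>)"

end

end

theory Submission
  imports Defs
begin

text \<open>
  Fix \<open>(u, v, w, t)\<close> and write \<open>z = (x, y, s)\<close>. Attaching multipliers to all constraints of the relaxation
  gives a Lagrangian \<open>L\<close>, a quadratic function of \<open>z\<close> with the same second-order part \<open>q\<close> as
  \<open>f u v w t\<close>. The block matrix of the semidefinite program is exactly the matrix of the homogenization
  of \<open>L - \<tau>\<close> by one extra scalar variable \<open>r\<close> (\<open>quadratic_form_sdp_matrix\<close>). Setting \<open>r = 0\<close>, it being
  positive semidefinite gives \<open>q \<ge> 0\<close>, that is, convexity of \<open>f u v w t\<close>; setting \<open>r = 1\<close>, it gives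
  \<open>\<tau> \<le> L\<close> everywhere; and these two conditions are also sufficient, by rescaling
  (\<open>SDP_feasible_iff\<close>). So the semidefinite program maximizes, jointly over the parameters with
  \<open>f u v w t\<close> convex and over the multipliers, a lower bound \<open>\<tau>\<close> of the Lagrangian.

  It remains to see that for fixed parameters the best such \<open>\<tau>\<close> is the value of the relaxation, and
  that some multipliers attain it. One inequality is weak duality (\<open>lagrangian_le_f\<close>). The other is
  strong duality for convex quadratic programs (\<open>convex_qp_strong_duality\<close>), which rests on the
  linearity of the constraints: the relaxation has a minimizer \<open>z0\<close> because its feasible set
  is compact and nonempty; at \<open>z0\<close> the linearization of the objective is minimal over the feasible
  polyhedron; the affine Farkas lemma turns this into multipliers; and a convex function lies above
  its linearization. Hence the relaxation value of every admissible \<open>(u, v, w, t)\<close> is the objective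
  value of a feasible point of the semidefinite program with the same parameters and bounds the
  objective of all such points, so that optimal values and optimal parameters of the two problems agree.
\<close>

section \<open>The affine Farkas lemma\<close>

text \<open>
  Identify an affine function with its vector of coefficients in \<open>'a \<times> real\<close>. The functions bounded
  below by nonnegative combinations of the constraints form the cone generated by the constraints
  and the constant \<open>1\<close>. This cone is closed because it is finitely generated, so a function outside
  it is separated from it by some \<open>(z, r)\<close> with \<open>r \<ge> 0\<close>. If \<open>r > 0\<close>, then \<open>z / r\<close> is a
  feasible point at which the function is negative; if \<open>r = 0\<close>, then \<open>z\<close> is a recession direction
  along which the function tends to \<open>-\<infinity>\<close>, starting at the feasible point \<open>z0\<close>. Both are impossible.
\<close>

lemma affine_farkas:
  fixes \<phi> :: "'i::finite \<Rightarrow> 'a::euclidean_space \<Rightarrow> real"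
  assumes lin: "\<And>i. linear (\<phi> i)" and linl: "linear \<rho>"
    and feas: "\<And>i. 0 \<le> \<phi> i z0 + \<alpha> i"
    and imp: "\<And>z. (\<And>i. 0 \<le> \<phi> i z + \<alpha> i) \<Longrightarrow> 0 \<le> \<rho> z + \<gamma>"
  obtains \<xi> where "\<And>i. 0 \<le> \<xi> i" "\<And>z. (\<Sum>i\<in>UNIV. \<xi> i * (\<phi> i z + \<alpha> i)) \<le> \<rho> z + \<gamma>"
proof -
  define p where "p i = adjoint (\<phi> i) 1" for i
  define l where "l = adjoint \<rho> 1"
  have p: "z \<bullet> p i = \<phi> i z" for i z
    using adjoint_works[OF lin, of z i 1] by (simp add: p_def)
  have l: "z \<bullet> l = \<rho> z" for z
    using adjoint_works[OF linl, of z 1] by (simp add: l_def)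
  define G where "G = insert (0, 1) (range (\<lambda>i. (p i, \<alpha> i)))"
  define K where "K = convex_cone hull G"
  have GK: "G \<subseteq> K" by (simp add: K_def hull_subset)
  have inK: "(l, \<gamma>) \<in> K"
  proof (rule ccontr)
    assume "(l, \<gamma>) \<notin> K"
    moreover have "convex K" "closed K"
      by (auto simp: K_def G_def convex_convex_cone_hull closed_convex_cone_hull)
    ultimately have "\<exists>n b. n \<bullet> (l, \<gamma>) < b \<and> (\<forall>x\<in>K. b < n \<bullet> x)"
      by (intro separating_hyperplane_closed_point)
    then obtain n b where nb: "n \<bullet> (l, \<gamma>) < b" "\<And>x. x \<in> K \<Longrightarrow> b < n \<bullet> x"
      by blast
    obtain z r where n: "n = (z, r)" by force
    have b: "b < 0" using nb(2)[of 0] by (simp add: K_def convex_cone_hull_contains_0)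
    \<comment> \<open>A linear function bounded below on a cone is nonnegative there.\<close>
    have pos: "0 \<le> n \<bullet> x" if "x \<in> K" for x
    proof (rule ccontr)
      assume neg: "\<not> 0 \<le> n \<bullet> x"
      have "(b / (n \<bullet> x)) *\<^sub>R x \<in> K"
        using that neg b unfolding K_def
        by (intro convex_cone_hull_mul) (auto simp: divide_nonpos_nonpos)
      from nb(2)[OF this] neg show False by simp
    qed
    have r: "0 \<le> r" using pos[of "(0, 1)"] GK by (auto simp: n G_def)
    have ph: "0 \<le> \<phi> i z + \<alpha> i * r" for i
      using pos[of "(p i, \<alpha> i)"] GK by (auto simp: n G_def p mult.commute)
    have neg: "\<rho> z + \<gamma> * r < 0" using nb(1) b by (simp add: n l mult.commute)
    show False
    proof (cases "r = 0")
      case False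
      with r have r: "r > 0" by simp
      have "0 \<le> \<phi> i (z /\<^sub>R r) + \<alpha> i" for i
        using ph[of i] r by (simp add: linear_scale[OF lin] field_simps)
      from imp[OF this] neg r show False
        by (simp add: linear_scale[OF linl] field_simps)
    next
      case True
      have z0: "0 \<le> \<rho> z0 + \<gamma>" using imp feas by blast
      \<comment> \<open>The step length at which the function has fallen to \<open>-1\<close>.\<close>
      define k where "k = (\<rho> z0 + \<gamma> + 1) / (- \<rho> z)"
      have k: "0 \<le> k" "k * \<rho> z = - (\<rho> z0 + \<gamma> + 1)"
        using z0 neg True by (auto simp: k_def divide_simps)
      have "0 \<le> \<phi> i (z0 + k *\<^sub>R z) + \<alpha> i" for i
        using feas[of i] mult_nonneg_nonneg[OF k(1) ph[of i]] True
        by (simp add: linear_add[OF lin] linear_scale[OF lin])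
      from imp[OF this] k(2) show False
        by (simp add: linear_add[OF linl] linear_scale[OF linl])
    qed
  qed
  \<comment> \<open>It remains to read off explicit coefficients from membership in the hull.\<close>
  define C where "C = {q. \<exists>\<xi> \<epsilon>. (\<forall>i. 0 \<le> \<xi> i) \<and> 0 \<le> \<epsilon> \<and>
      q = (\<Sum>i\<in>UNIV. \<xi> i *\<^sub>R p i, (\<Sum>i\<in>UNIV. \<xi> i * \<alpha> i) + (\<epsilon>::real))}"
  have CI: "(\<Sum>i\<in>UNIV. \<xi> i *\<^sub>R p i, (\<Sum>i\<in>UNIV. \<xi> i * \<alpha> i) + \<epsilon>) \<in> C"
    if "\<forall>i. 0 \<le> \<xi> i" "0 \<le> \<epsilon>" for \<xi> \<epsilon>
    using that unfolding C_def by blast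
  have KC: "K \<subseteq> C"
    unfolding K_def
  proof (rule hull_minimal)
    have "(p i, \<alpha> i) \<in> C" for i
    proof -
      have "(\<Sum>j\<in>UNIV. (if i = j then 1 else 0) *\<^sub>R p j) = p i"
        by (simp add: if_distrib[where f="\<lambda>c. c *\<^sub>R _"] cong: if_cong)
      moreover have "(\<Sum>j\<in>UNIV. (if i = j then 1 else 0) * \<alpha> j) = \<alpha> i"
        by (simp add: if_distrib[where f="\<lambda>c. c * _"] cong: if_cong)
      ultimately show ?thesis using CI[of "\<lambda>j. if i = j then 1 else 0" 0] by simp
    qed
    moreover have "(0, 1) \<in> C" using CI[of "\<lambda>_. 0" 1] by simp
    ultimately show "G \<subseteq> C" by (auto simp: G_def)
    show "convex_cone C"
      unfolding convex_cone_iff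
    proof (intro conjI ballI allI impI)
      show "0 \<in> C" using CI[of "\<lambda>_. 0" 0] by (simp add: zero_prod_def)
    next
      fix x y assume "x \<in> C" "y \<in> C"
      then obtain \<xi> \<epsilon> \<xi>' \<epsilon>' where *: "\<forall>i. 0 \<le> \<xi> i" "0 \<le> \<epsilon>" "\<forall>i. 0 \<le> \<xi>' i" "0 \<le> \<epsilon>'"
        "x = (\<Sum>i\<in>UNIV. \<xi> i *\<^sub>R p i, (\<Sum>i\<in>UNIV. \<xi> i * \<alpha> i) + \<epsilon>)"
        "y = (\<Sum>i\<in>UNIV. \<xi>' i *\<^sub>R p i, (\<Sum>i\<in>UNIV. \<xi>' i * \<alpha> i) + \<epsilon>')"
        unfolding C_def by blast
      then show "x + y \<in> C"
        using CI[of "\<lambda>i. \<xi> i + \<xi>' i" "\<epsilon> + \<epsilon>'"]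
        by (simp add: scaleR_add_left distrib_right sum.distrib algebra_simps)
    next
      fix x and k :: real assume "x \<in> C" "0 \<le> k"
      then obtain \<xi> \<epsilon> where *: "\<forall>i. 0 \<le> \<xi> i" "0 \<le> \<epsilon>"
        "x = (\<Sum>i\<in>UNIV. \<xi> i *\<^sub>R p i, (\<Sum>i\<in>UNIV. \<xi> i * \<alpha> i) + \<epsilon>)"
        unfolding C_def by blast
      with \<open>0 \<le> k\<close> show "k *\<^sub>R x \<in> C"
        using CI[of "\<lambda>i. k * \<xi> i" "k * \<epsilon>"]
        by (simp add: scaleR_sum_right sum_distrib_left distrib_left mult.assoc)
    qed
  qed
  have "(l, \<gamma>) \<in> C" using inK KC by blast
  then obtain \<xi> \<epsilon> where *: "\<forall>i. 0 \<le> \<xi> i" "0 \<le> \<epsilon>"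
    "l = (\<Sum>i\<in>UNIV. \<xi> i *\<^sub>R p i)" "\<gamma> = (\<Sum>i\<in>UNIV. \<xi> i * \<alpha> i) + \<epsilon>"
    unfolding C_def by auto
  have "(\<Sum>i\<in>UNIV. \<xi> i * (\<phi> i z + \<alpha> i)) \<le> \<rho> z + \<gamma>" for z
  proof -
    have "\<rho> z = (\<Sum>i\<in>UNIV. \<xi> i * \<phi> i z)"
      unfolding l[symmetric] *(3) by (simp add: inner_sum_right p)
    with *(2,4) show ?thesis by (simp add: distrib_left sum.distrib)
  qed
  with *(1) that show thesis by blast
qed

lemma all_sum_iff: "(\<forall>i. P i) \<longleftrightarrow> (\<forall>i. P (Inl i)) \<and> (\<forall>i. P (Inr i))"
  by (metis sum.exhaust)

lemma sum_over_sum_type: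
  fixes f :: "'a::finite + 'b::finite \<Rightarrow> 'c::comm_monoid_add"
  shows "sum f UNIV = (\<Sum>i\<in>UNIV. f (Inl i)) + (\<Sum>i\<in>UNIV. f (Inr i))"
  using sum.Plus[of UNIV UNIV f] by (simp add: comp_def)

text \<open>
  Each equation is split into two opposite inequalities; the difference of their multipliers is a
  multiplier of unrestricted sign.
\<close>

lemma affine_farkas_eq:
  fixes \<phi> :: "'i::finite \<Rightarrow> 'a::euclidean_space \<Rightarrow> real"
    and \<psi> :: "'j::finite \<Rightarrow> 'a \<Rightarrow> real"
  assumes lin: "\<And>i. linear (\<phi> i)" "\<And>j. linear (\<psi> j)" "linear \<rho>"
    and feas: "\<And>i. 0 \<le> \<phi> i z0 + \<alpha> i" "\<And>j. \<psi> j z0 + \<beta> j = 0"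
    and imp: "\<And>z. (\<And>i. 0 \<le> \<phi> i z + \<alpha> i) \<Longrightarrow> (\<And>j. \<psi> j z + \<beta> j = 0) \<Longrightarrow> 0 \<le> \<rho> z + \<gamma>"
  obtains \<xi> \<eta> where "\<And>i. 0 \<le> \<xi> i"
    "\<And>z. (\<Sum>i\<in>UNIV. \<xi> i * (\<phi> i z + \<alpha> i)) \<le> \<rho> z + \<gamma> + (\<Sum>j\<in>UNIV. \<eta> j * (\<psi> j z + \<beta> j))"
proof -
  define \<Phi> :: "'i + 'j + 'j \<Rightarrow> 'a \<Rightarrow> real" where
    "\<Phi> = case_sum \<phi> (case_sum \<psi> (\<lambda>j z. - \<psi> j z))"
  define \<Delta> where "\<Delta> = case_sum \<alpha> (case_sum \<beta> (\<lambda>j. - \<beta> j))"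
  have "linear (\<Phi> k)" for k
    using lin by (auto simp: \<Phi>_def linear_compose_neg split: sum.split)
  moreover have "\<psi> j z0 = - \<beta> j" for j
    using feas(2)[of j] by simp
  then have "0 \<le> \<Phi> k z0 + \<Delta> k" for k
    using feas(1) by (auto simp: \<Phi>_def \<Delta>_def split: sum.split)
  moreover have "0 \<le> \<rho> z + \<gamma>" if *: "\<And>k. 0 \<le> \<Phi> k z + \<Delta> k" for z
  proof (rule imp)
    show "0 \<le> \<phi> i z + \<alpha> i" for i using *[of "Inl i"] by (simp add: \<Phi>_def \<Delta>_def)
    show "\<psi> j z + \<beta> j = 0" for j
      using *[of "Inr (Inl j)"] *[of "Inr (Inr j)"] by (simp add: \<Phi>_def \<Delta>_def)
  qed
  ultimately obtain \<xi> where \<xi>: "\<And>k. 0 \<le> \<xi> k"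
    "\<And>z. (\<Sum>k\<in>UNIV. \<xi> k * (\<Phi> k z + \<Delta> k)) \<le> \<rho> z + \<gamma>"
    using affine_farkas[of \<Phi> \<rho> z0 \<Delta> \<gamma>] lin(3) by blast
  show thesis
  proof (rule that[of "\<lambda>i. \<xi> (Inl i)" "\<lambda>j. \<xi> (Inr (Inr j)) - \<xi> (Inr (Inl j))"])
    show "0 \<le> \<xi> (Inl i)" for i by (rule \<xi>(1))
    show "(\<Sum>i\<in>UNIV. \<xi> (Inl i) * (\<phi> i z + \<alpha> i)) \<le> \<rho> z + \<gamma> +
      (\<Sum>j\<in>UNIV. (\<xi> (Inr (Inr j)) - \<xi> (Inr (Inl j))) * (\<psi> j z + \<beta> j))" for z
      using \<xi>(2)[of z]
      by (simp add: sum_over_sum_type \<Phi>_def \<Delta>_def algebra_simps sum.distrib sum_subtractf sum_negf)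
  qed
qed

section \<open>Strong duality for convex quadratic programs\<close>

text \<open>
  The gap between a chord and the graph of a quadratic function at the point dividing \<open>z, z'\<close> in
  the ratio \<open>\<theta> : 1 - \<theta>\<close> is \<open>\<theta> (1 - \<theta>)\<close> times the quadratic form at \<open>z - z'\<close>.
\<close>

lemma convex_quadratic_iff:
  fixes \<beta> :: "'a::real_vector \<Rightarrow> 'a \<Rightarrow> real"
  assumes bil: "bilinear \<beta>" and sym: "\<And>z z'. \<beta> z z' = \<beta> z' z" and lin: "linear \<rho>"
  shows "convex_on UNIV (\<lambda>z. \<beta> z z + \<rho> z + \<gamma>) \<longleftrightarrow> (\<forall>z. 0 \<le> \<beta> z z)"
    (is "convex_on UNIV ?q \<longleftrightarrow> _")
proof -
  note simps = bilinear_ladd[OF bil] bilinear_radd[OF bil] bilinear_lsub[OF bil]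
    bilinear_rsub[OF bil] bilinear_lmul[OF bil] bilinear_rmul[OF bil]
    linear_add[OF lin] linear_scale[OF lin]
  have key: "(1 - \<theta>) * ?q z + \<theta> * ?q z' - ?q ((1 - \<theta>) *\<^sub>R z + \<theta> *\<^sub>R z')
      = \<theta> * (1 - \<theta>) * \<beta> (z - z') (z - z')" for \<theta> z z'
    by (simp add: simps sym[of z' z]) algebra
  show ?thesis
  proof
    assume conv: "convex_on UNIV ?q"
    show "\<forall>z. 0 \<le> \<beta> z z"
    proof
      fix z
      have "?q ((1 - 1/2) *\<^sub>R z + (1/2) *\<^sub>R 0) \<le> (1 - 1/2) * ?q z + (1/2) * ?q 0"
        by (rule convex_onD[OF conv]) auto
      with key[of "1/2" z 0] have "0 \<le> 1/2 * (1 - 1/2) * \<beta> (z - 0) (z - 0)" by linarith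
      then show "0 \<le> \<beta> z z" by simp
    qed
  next
    assume nn: "\<forall>z. 0 \<le> \<beta> z z"
    show "convex_on UNIV ?q"
    proof (rule convex_onI)
      fix \<theta> :: real and z z' assume "0 < \<theta>" "\<theta> < 1"
      then have "0 \<le> \<theta> * (1 - \<theta>) * \<beta> (z - z') (z - z')" using nn by simp
      with key[of \<theta> z z']
      show "?q ((1 - \<theta>) *\<^sub>R z + \<theta> *\<^sub>R z') \<le> (1 - \<theta>) * ?q z + \<theta> * ?q z'" by linarith
    qed simp
  qed
qed

text \<open>
  The linearization \<open>q z0 + D z - D z0\<close> of \<open>q\<close> at the minimizer \<open>z0\<close> is minimal at \<open>z0\<close> over the same
  polyhedron, so the affine Farkas lemma provides multipliers for it. They serve \<open>q\<close> as well, since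
  \<open>q\<close> exceeds its linearization by \<open>\<beta> (z - z0) (z - z0) \<ge> 0\<close>.
\<close>

lemma convex_qp_strong_duality:
  fixes \<phi> :: "'i::finite \<Rightarrow> 'a::euclidean_space \<Rightarrow> real"
    and \<psi> :: "'j::finite \<Rightarrow> 'a \<Rightarrow> real"
  assumes bil: "bilinear \<beta>" and sym: "\<And>z z'. \<beta> z z' = \<beta> z' z" and nonneg: "\<And>z. 0 \<le> \<beta> z z"
    and lin: "linear \<rho>" and linc: "\<And>i. linear (\<phi> i)" "\<And>j. linear (\<psi> j)"
    and q: "\<And>z. q z = \<beta> z z + \<rho> z + \<gamma>"
    and feas: "\<And>i. 0 \<le> \<phi> i z0 + \<alpha> i" "\<And>j. \<psi> j z0 + \<kappa> j = 0"
    and min: "\<And>z. (\<And>i. 0 \<le> \<phi> i z + \<alpha> i) \<Longrightarrow> (\<And>j. \<psi> j z + \<kappa> j = 0) \<Longrightarrow> q z0 \<le> q z"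
  obtains \<xi> \<eta> where "\<And>i. 0 \<le> \<xi> i"
    "\<And>z. q z0 \<le> q z - (\<Sum>i\<in>UNIV. \<xi> i * (\<phi> i z + \<alpha> i)) + (\<Sum>j\<in>UNIV. \<eta> j * (\<psi> j z + \<kappa> j))"
proof -
  note simps = bilinear_ladd[OF bil] bilinear_radd[OF bil] bilinear_lsub[OF bil]
    bilinear_rsub[OF bil] bilinear_lmul[OF bil] bilinear_rmul[OF bil]
    linear_add[OF lin] linear_scale[OF lin] linear_diff[OF lin]
  define D where "D z = 2 * \<beta> z0 z + \<rho> z" for z
  have linD: "linear D"
    by (intro linearI) (simp_all add: D_def simps algebra_simps)
  have expand: "q (z0 + \<theta> *\<^sub>R (z - z0)) = q z0 + \<theta> * (D z - D z0) + \<theta>\<^sup>2 * \<beta> (z - z0) (z - z0)" for \<theta> z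
    by (simp add: q D_def simps sym[of z z0]) algebra
  have first_order: "0 \<le> D z + - D z0"
    if z: "\<And>i. 0 \<le> \<phi> i z + \<alpha> i" "\<And>j. \<psi> j z + \<kappa> j = 0" for z
  proof (rule ccontr)
    assume "\<not> 0 \<le> D z + - D z0"
    then have neg: "D z - D z0 < 0" by simp
    define b where "b = \<beta> (z - z0) (z - z0)"
    \<comment> \<open>A step towards \<open>z\<close> so short that the negative first-order term beats \<open>\<theta>\<^sup>2 b\<close>; the \<open>+ 1\<close> only
      keeps the denominator positive.\<close>
    define \<theta> where "\<theta> = min 1 (- (D z - D z0) / (2 * (b + 1)))"
    have b: "0 \<le> b" by (simp add: b_def nonneg)
    have \<theta>: "0 < \<theta>" "\<theta> \<le> 1" using neg b by (auto simp: \<theta>_def)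
    have \<theta>b: "\<theta> * b < - (D z - D z0)"
    proof -
      have "\<theta> * (2 * (b + 1)) \<le> - (D z - D z0)"
        using b by (simp add: \<theta>_def flip: pos_le_divide_eq)
      moreover have "\<theta> * b < \<theta> * (2 * (b + 1))"
        using \<theta> b by (intro mult_strict_left_mono) auto
      ultimately show ?thesis by simp
    qed
    have "q z0 \<le> q (z0 + \<theta> *\<^sub>R (z - z0))"
    proof (rule min)
      show "0 \<le> \<phi> i (z0 + \<theta> *\<^sub>R (z - z0)) + \<alpha> i" for i
      proof -
        have "\<phi> i (z0 + \<theta> *\<^sub>R (z - z0)) + \<alpha> i = (1 - \<theta>) * (\<phi> i z0 + \<alpha> i) + \<theta> * (\<phi> i z + \<alpha> i)"
          by (simp add: linear_add[OF linc(1)] linear_scale[OF linc(1)] linear_diff[OF linc(1)] algebra_simps)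
        then show ?thesis using z(1)[of i] feas(1)[of i] \<theta> by simp
      qed
      show "\<psi> j (z0 + \<theta> *\<^sub>R (z - z0)) + \<kappa> j = 0" for j
      proof -
        have "\<psi> j (z0 + \<theta> *\<^sub>R (z - z0)) + \<kappa> j = (1 - \<theta>) * (\<psi> j z0 + \<kappa> j) + \<theta> * (\<psi> j z + \<kappa> j)"
          by (simp add: linear_add[OF linc(2)] linear_scale[OF linc(2)] linear_diff[OF linc(2)] algebra_simps)
        then show ?thesis using z(2)[of j] feas(2)[of j] by simp
      qed
    qed
    then have "0 \<le> \<theta> * (D z - D z0) + \<theta>\<^sup>2 * b"
      using expand[of \<theta> z] unfolding b_def by linarith
    also have "\<dots> = \<theta> * ((D z - D z0) + \<theta> * b)"
      by (simp add: power2_eq_square algebra_simps)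
    finally have "0 \<le> \<theta> * ((D z - D z0) + \<theta> * b)" .
    with \<theta> \<theta>b show False by (simp add: zero_le_mult_iff)
  qed
  obtain \<xi> \<eta> where *: "\<And>i. 0 \<le> \<xi> i"
    "\<And>z. (\<Sum>i\<in>UNIV. \<xi> i * (\<phi> i z + \<alpha> i)) \<le> D z + - D z0 + (\<Sum>j\<in>UNIV. \<eta> j * (\<psi> j z + \<kappa> j))"
    by (rule affine_farkas_eq[of \<phi> \<psi> D z0 \<alpha> \<kappa> "- D z0"]) (use linc linD feas first_order in blast)+
  have lower: "q z0 + (D z - D z0) \<le> q z" for z
    using expand[of 1 z] nonneg[of "z - z0"] by simp
  have "q z0 \<le> q z - (\<Sum>i\<in>UNIV. \<xi> i * (\<phi> i z + \<alpha> i)) + (\<Sum>j\<in>UNIV. \<eta> j * (\<psi> j z + \<kappa> j))" for z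
    using *(2)[of z] lower[of z] by linarith
  with *(1) that show thesis by blast
qed

section \<open>The quadratic form of a symmetric block matrix\<close>

definition join4 :: "real^'n \<Rightarrow> real^'p \<Rightarrow> real^'m \<Rightarrow> real \<Rightarrow> real^('n + 'p + 'm + unit)" where
  "join4 x y s r = (\<chi> i. case i of Inl i \<Rightarrow> x $ i | Inr (Inl i) \<Rightarrow> y $ i
     | Inr (Inr (Inl i)) \<Rightarrow> s $ i | Inr (Inr (Inr _)) \<Rightarrow> r)"

lemma join4_exhaust: obtains x y s r where "z = join4 x y s r"
proof
  show "z = join4 (\<chi> i. z $ Inl i) (\<chi> i. z $ Inr (Inl i)) (\<chi> i. z $ Inr (Inr (Inl i)))
    (z $ Inr (Inr (Inr ())))"
    by (auto simp: join4_def vec_eq_iff split: sum.split)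
qed

lemma inner_join4: "join4 x y s r \<bullet> join4 x' y' s' r' = x \<bullet> x' + y \<bullet> y' + s \<bullet> s' + r * r'"
  by (simp add: inner_vec_def sum_over_sum_type join4_def)

lemma sym_block4_mult_join4:
  "sym_block4 M11 M12 M13 m14 M22 M23 m24 M33 m34 m44 *v join4 x y s r =
    join4 (M11 *v x + M12 *v y + M13 *v s + r *\<^sub>R m14)
      (transpose M12 *v x + M22 *v y + M23 *v s + r *\<^sub>R m24)
      (transpose M13 *v x + transpose M23 *v y + M33 *v s + r *\<^sub>R m34)
      (m14 \<bullet> x + m24 \<bullet> y + m34 \<bullet> s + r * m44)"
  by (auto simp: vec_eq_iff join4_def matrix_vector_mult_def sum_over_sum_type sym_block4_def
      inner_vec_def split: sum.split)

lemma inner_transpose_mult: "y \<bullet> (transpose M *v x) = x \<bullet> (M *v (y :: real^'m))"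
  by (metis dot_lmul_matrix vector_transpose_matrix transpose_transpose inner_commute)

lemma quadratic_form_sym_block4:
  "join4 x y s r \<bullet> (sym_block4 M11 M12 M13 m14 M22 M23 m24 M33 m34 m44 *v join4 x y s r) =
    x \<bullet> (M11 *v x) + y \<bullet> (M22 *v y) + s \<bullet> (M33 *v s)
    + 2 * (x \<bullet> (M12 *v y) + x \<bullet> (M13 *v s) + y \<bullet> (M23 *v s))
    + 2 * r * (m14 \<bullet> x + m24 \<bullet> y + m34 \<bullet> s) + r\<^sup>2 * m44"
  by (simp add: sym_block4_mult_join4 inner_join4 inner_add_right inner_transpose_mult
      inner_commute[of x m14] inner_commute[of y m24] inner_commute[of s m34]
      power2_eq_square algebra_simps del: transpose_matrix_vector)

lemma psd_sym_block4_iff: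
  assumes "transpose M11 = M11" "transpose M22 = M22" "transpose M33 = M33"
  shows "psd (sym_block4 M11 M12 M13 m14 M22 M23 m24 M33 m34 m44) \<longleftrightarrow>
    (\<forall>x y s r. 0 \<le> join4 x y s r \<bullet> (sym_block4 M11 M12 M13 m14 M22 M23 m24 M33 m34 m44 *v join4 x y s r))"
proof -
  let ?X = "sym_block4 M11 M12 M13 m14 M22 M23 m24 M33 m34 m44"
  have "sym_block4_entry M11 M12 M13 m14 M22 M23 m24 M33 m34 m44 j i
      = sym_block4_entry M11 M12 M13 m14 M22 M23 m24 M33 m34 m44 i j" for i j
    using assms
    by (cases "(M11, M12, M13, m14, M22, M23, m24, M33, m34, m44, i, j)" rule: sym_block4_entry.cases)
      (simp_all add: transpose_def vec_eq_iff)
  then have "transpose ?X = ?X" by (simp add: transpose_def sym_block4_def vec_eq_iff)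
  then show ?thesis unfolding psd_def by (metis join4_exhaust)
qed

section \<open>The objective as a quadratic function\<close>

lemma diag_mult_nth [simp]: "(diag r *v x) $ i = r $ i * x $ i"
  by (simp add: diag_def matrix_vector_mult_def if_distrib[where f="\<lambda>c. c * _"] cong: if_cong)

lemma inner_diag_commute: "p \<bullet> (diag r *v q) = q \<bullet> (diag r *v p)"
  by (simp add: inner_vec_def algebra_simps)

lemma inner_diag_left: "(diag r *v p) \<bullet> q = p \<bullet> (diag r *v q)"
  by (simp add: inner_vec_def algebra_simps)

lemma transpose_diag [simp]: "transpose (diag r) = diag r"
  by (auto simp: transpose_def diag_def vec_eq_iff)

lemma transpose_add: "transpose (M + N) = transpose M + transpose (N :: real^'n^'m)"
  by (simp add: transpose_def vec_eq_iff)

lemma transpose_congruence_diag: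
  "transpose (transpose M ** diag r ** M) = transpose M ** diag r ** (M :: real^'n^'m)"
  by (simp add: matrix_transpose_mul matrix_mul_assoc)

context mixed_binary_qp
begin

text \<open>
  The polar form of the second-order part of \<open>f u v w t\<close>. The cross term in \<open>u\<close> is symmetrized so
  that the form is symmetric in its two arguments.
\<close>

definition quad_part where
  "quad_part u v w t = (\<lambda>(x, y, s) (x', y', s').
     x \<bullet> (Q *v x') + (x \<bullet> (diag u *v y') + x' \<bullet> (diag u *v y)) / 2 + y \<bullet> (diag v *v y')
     + (E *v x + F *v y) \<bullet> (diag w *v (E *v x' + F *v y'))
     + (A *v x + B *v y + s) \<bullet> (diag t *v (A *v x' + B *v y' + s')))"

definition lin_part where
  "lin_part u v w t = (\<lambda>(x, y, s). c \<bullet> x + h \<bullet> y - u \<bullet> x - v \<bullet> y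
     - 2 * (g \<bullet> (diag w *v (E *v x + F *v y))) - 2 * (d \<bullet> (diag t *v (A *v x + B *v y + s))))"

definition const_part where
  "const_part w t = g \<bullet> (diag w *v g) + d \<bullet> (diag t *v d)"

lemma f_decompose:
  "f u v w t z = quad_part u v w t z z + lin_part u v w t z + const_part w t"
proof -
  have square: "(p - q) \<bullet> (diag r *v (p - q))
      = p \<bullet> (diag r *v p) - 2 * (q \<bullet> (diag r *v p)) + q \<bullet> (diag r *v q)"
    for p q :: "real^'i" and r
    using inner_diag_commute[of p r q]
    by (simp add: matrix_vector_mult_diff_distrib inner_diff_left inner_diff_right)
  obtain x y s where z: "z = (x, y, s)" by (cases z) auto
  have "(\<Sum>i\<in>UNIV. u $ i * x $ i * y $ i + v $ i * (y $ i)\<^sup>2 - u $ i * x $ i - v $ i * y $ i)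
      = x \<bullet> (diag u *v y) + y \<bullet> (diag v *v y) - u \<bullet> x - v \<bullet> y"
    by (simp add: inner_vec_def sum.distrib sum_subtractf power2_eq_square algebra_simps)
  then show ?thesis
    unfolding z f_def quad_part_def lin_part_def const_part_def prod.case square by simp
qed

lemma bilinear_quad_part: "bilinear (quad_part u v w t)"
  unfolding bilinear_def
  by (intro conjI allI linearI)
    (auto simp: quad_part_def matrix_vector_right_distrib matrix_vector_mult_scaleR
      inner_add_left inner_add_right algebra_simps add_divide_distrib)

lemma quad_part_commute:
  assumes "transpose Q = Q"
  shows "quad_part u v w t z z' = quad_part u v w t z' z"
proof -
  have "p \<bullet> (Q *v q) = q \<bullet> (Q *v p)" for p q
    using inner_transpose_mult[of p Q q] assms by simp
  then show ?thesis
    using inner_diag_commute[of "E *v fst z + F *v fst (snd z)" w "E *v fst z' + F *v fst (snd z')"]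
      inner_diag_commute[of "A *v fst z + B *v fst (snd z) + snd (snd z)" t
        "A *v fst z' + B *v fst (snd z') + snd (snd z')"]
      inner_diag_commute[of "fst (snd z)" v "fst (snd z')"]
    by (simp add: quad_part_def case_prod_beta)
qed

lemma linear_lin_part: "linear (lin_part u v w t)"
  by (intro linearI)
    (auto simp: lin_part_def matrix_vector_right_distrib matrix_vector_mult_scaleR
      inner_add_right algebra_simps)

section \<open>The Lagrangian and the block matrix\<close>

text \<open>
  The linear part of the multiplier terms of the Lagrangian. It is kept apart from their constant
  part because homogenization weights the two by \<open>r\<close> and \<open>r\<^sup>2\<close>.
\<close>

definition lagr_lin where
  "lagr_lin \<delta> \<mu> \<sigma> \<nu> \<pi> \<eta> \<zeta> = (\<lambda>(x, y, s). \<eta> \<bullet> (A *v x + B *v y + s) + \<zeta> \<bullet> (E *v x + F *v y)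
     - \<delta> \<bullet> s - \<mu> \<bullet> (x - diag a *v y) - \<sigma> \<bullet> (diag b *v y - x) - \<nu> \<bullet> y + \<pi> \<bullet> y)"

text \<open>
  Here \<open>\<eta>\<close> and \<open>\<zeta>\<close> belong to the equations, and \<open>\<delta>, \<mu>, \<sigma>, \<nu>, \<pi>\<close> to \<open>s \<ge> 0\<close>, \<open>a y \<le> x\<close>, \<open>x \<le> b y\<close>,
  \<open>y \<ge> 0\<close> and \<open>y \<le> 1\<close>, in this order.
\<close>

definition lagrangian where
  "lagrangian \<delta> \<mu> \<sigma> \<nu> \<pi> \<eta> \<zeta> u v w t = (\<lambda>(x, y, s). f u v w t (x, y, s)
     + \<eta> \<bullet> (A *v x + B *v y + s - d) + \<zeta> \<bullet> (E *v x + F *v y - g)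
     - \<delta> \<bullet> s - \<mu> \<bullet> (x - diag a *v y) - \<sigma> \<bullet> (diag b *v y - x) - \<nu> \<bullet> y - \<pi> \<bullet> (1 - y))"

lemma linear_lagr_lin: "linear (lagr_lin \<delta> \<mu> \<sigma> \<nu> \<pi> \<eta> \<zeta>)"
  by (intro linearI)
    (auto simp: lagr_lin_def matrix_vector_right_distrib matrix_vector_mult_scaleR
      inner_add_right inner_diff_right algebra_simps)

lemma lagrangian_decompose:
  "lagrangian \<delta> \<mu> \<sigma> \<nu> \<pi> \<eta> \<zeta> u v w t z
    = quad_part u v w t z z + (lin_part u v w t z + lagr_lin \<delta> \<mu> \<sigma> \<nu> \<pi> \<eta> \<zeta> z)
      + (const_part w t - \<eta> \<bullet> d - \<zeta> \<bullet> g - 1 \<bullet> \<pi>)"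
  by (auto simp: lagrangian_def lagr_lin_def f_decompose inner_diff_right inner_commute[of _ 1]
      split: prod.split)

definition sdp_matrix where
  "sdp_matrix \<delta> \<mu> \<sigma> \<nu> \<pi> \<eta> \<zeta> u v w t \<tau> = sym_block4
     (P11 w t) (P12 u w t) (P13 t) (P14 \<mu> \<sigma> \<eta> \<zeta> u w t)
     (P22 v w t) (P23 t) (P24 \<mu> \<sigma> \<nu> \<pi> \<eta> \<zeta> v w t) (P33 t) (P34 \<delta> \<eta> t) (P44 \<pi> \<eta> \<zeta> w t \<tau>)"

text \<open>
  The \<open>P\<close> blocks are the coefficients of the homogenization \<open>r\<^sup>2 (L (z / r) - \<tau>)\<close> of \<open>L - \<tau>\<close>: the
  identity is a comparison of coefficients.
\<close>

lemma quadratic_form_sdp_matrix: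
  "join4 x y s r \<bullet> (sdp_matrix \<delta> \<mu> \<sigma> \<nu> \<pi> \<eta> \<zeta> u v w t \<tau> *v join4 x y s r)
    = quad_part u v w t (x, y, s) (x, y, s)
      + r * (lin_part u v w t (x, y, s) + lagr_lin \<delta> \<mu> \<sigma> \<nu> \<pi> \<eta> \<zeta> (x, y, s))
      + r\<^sup>2 * (const_part w t - \<eta> \<bullet> d - \<zeta> \<bullet> g - 1 \<bullet> \<pi> - \<tau>)"
proof -
  have tr: "p \<bullet> (transpose M *v q) = (M *v p) \<bullet> q" for p :: "real^'i" and q :: "real^'j" and M
    by (simp add: inner_transpose_mult inner_commute del: transpose_matrix_vector)
  have tl: "(transpose M *v q) \<bullet> p = q \<bullet> (M *v p)" for p :: "real^'i" and q :: "real^'j" and M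
    using tr[of p M q] by (simp add: inner_commute del: transpose_matrix_vector)
  have 11: "x \<bullet> (P11 w t *v x) = x \<bullet> (Q *v x) + (E *v x) \<bullet> (diag w *v (E *v x))
      + (A *v x) \<bullet> (diag t *v (A *v x))"
    by (simp add: P11_def matrix_vector_mult_add_rdistrib inner_add_right tr
        matrix_vector_mul_assoc[symmetric] del: transpose_matrix_vector)
  have 22: "y \<bullet> (P22 v w t *v y) = y \<bullet> (diag v *v y) + (F *v y) \<bullet> (diag w *v (F *v y))
      + (B *v y) \<bullet> (diag t *v (B *v y))"
    by (simp add: P22_def matrix_vector_mult_add_rdistrib inner_add_right tr
        matrix_vector_mul_assoc[symmetric] del: transpose_matrix_vector)
  have 12: "x \<bullet> (P12 u w t *v y) = (x \<bullet> (diag u *v y)) / 2 + (E *v x) \<bullet> (diag w *v (F *v y))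
      + (A *v x) \<bullet> (diag t *v (B *v y))"
    by (simp add: P12_def matrix_vector_mult_add_rdistrib inner_add_right tr
        matrix_vector_mul_assoc[symmetric] scaleR_matrix_vector_assoc[symmetric]
        del: transpose_matrix_vector)
  have 13: "x \<bullet> (P13 t *v s) = (A *v x) \<bullet> (diag t *v s)" "y \<bullet> (P23 t *v s) = (B *v y) \<bullet> (diag t *v s)"
    by (simp_all add: P13_def P23_def tr matrix_vector_mul_assoc[symmetric] del: transpose_matrix_vector)
  have 14: "2 * (P14 \<mu> \<sigma> \<eta> \<zeta> u w t \<bullet> x) = c \<bullet> x - u \<bullet> x + \<eta> \<bullet> (A *v x) + \<zeta> \<bullet> (E *v x)
      - 2 * (g \<bullet> (diag w *v (E *v x))) - 2 * (d \<bullet> (diag t *v (A *v x))) - \<mu> \<bullet> x + \<sigma> \<bullet> x"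
    by (simp add: P14_def inner_add_left inner_diff_left tl inner_diag_left
        matrix_vector_mul_assoc[symmetric] del: transpose_matrix_vector)
  have 24: "2 * (P24 \<mu> \<sigma> \<nu> \<pi> \<eta> \<zeta> v w t \<bullet> y) = h \<bullet> y - v \<bullet> y + \<eta> \<bullet> (B *v y) + \<zeta> \<bullet> (F *v y)
      - 2 * (g \<bullet> (diag w *v (F *v y))) - 2 * (d \<bullet> (diag t *v (B *v y)))
      + \<mu> \<bullet> (diag a *v y) - \<sigma> \<bullet> (diag b *v y) - \<nu> \<bullet> y + \<pi> \<bullet> y"
    by (simp add: P24_def inner_add_left inner_diff_left tl inner_diag_left
        matrix_vector_mul_assoc[symmetric] del: transpose_matrix_vector)
  have 34: "2 * (P34 \<delta> \<eta> t \<bullet> s) = \<eta> \<bullet> s - \<delta> \<bullet> s - 2 * (d \<bullet> (diag t *v s))"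
    by (simp add: P34_def inner_diff_left inner_diag_left)
  have 44: "P44 \<pi> \<eta> \<zeta> w t \<tau> = const_part w t - \<eta> \<bullet> d - \<zeta> \<bullet> g - 1 \<bullet> \<pi> - \<tau>"
    by (simp add: P44_def const_part_def)
  have "2 * r * (P14 \<mu> \<sigma> \<eta> \<zeta> u w t \<bullet> x + P24 \<mu> \<sigma> \<nu> \<pi> \<eta> \<zeta> v w t \<bullet> y + P34 \<delta> \<eta> t \<bullet> s)
      = r * (2 * (P14 \<mu> \<sigma> \<eta> \<zeta> u w t \<bullet> x) + 2 * (P24 \<mu> \<sigma> \<nu> \<pi> \<eta> \<zeta> v w t \<bullet> y) + 2 * (P34 \<delta> \<eta> t \<bullet> s))"
    by (simp add: algebra_simps)
  also have "\<dots> = r * (lin_part u v w t (x, y, s) + lagr_lin \<delta> \<mu> \<sigma> \<nu> \<pi> \<eta> \<zeta> (x, y, s))"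
    unfolding 14 24 34
    by (simp add: lin_part_def lagr_lin_def matrix_vector_right_distrib inner_add_right inner_diff_right)
  finally have cross: "2 * r * (P14 \<mu> \<sigma> \<eta> \<zeta> u w t \<bullet> x + P24 \<mu> \<sigma> \<nu> \<pi> \<eta> \<zeta> v w t \<bullet> y + P34 \<delta> \<eta> t \<bullet> s)
      = r * (lin_part u v w t (x, y, s) + lagr_lin \<delta> \<mu> \<sigma> \<nu> \<pi> \<eta> \<zeta> (x, y, s))" .
  have quad: "x \<bullet> (P11 w t *v x) + y \<bullet> (P22 v w t *v y) + s \<bullet> (P33 t *v s)
      + 2 * (x \<bullet> (P12 u w t *v y) + x \<bullet> (P13 t *v s) + y \<bullet> (P23 t *v s))
      = quad_part u v w t (x, y, s) (x, y, s)"
    unfolding 11 22 12 13 P33_def quad_part_def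
    using inner_diag_commute[of "F *v y" w "E *v x"] inner_diag_commute[of "B *v y" t "A *v x"]
      inner_diag_commute[of s t "A *v x"] inner_diag_commute[of s t "B *v y"]
    by (simp add: matrix_vector_right_distrib inner_add_left inner_add_right)
  show ?thesis
    unfolding sdp_matrix_def quadratic_form_sym_block4 quad cross 44 ..
qed

text \<open>
  On the slice \<open>r = 0\<close> the form of the block matrix is the second-order part of \<open>f\<close>; off this slice
  it is \<open>r\<^sup>2\<close> times the value of \<open>L - \<tau>\<close> at \<open>z / r\<close>.
\<close>

lemma SDP_feasible_iff:
  assumes sym: "transpose Q = Q"
  shows "((\<delta>, \<mu>, \<sigma>, \<nu>, \<pi>), (\<eta>, \<zeta>, u, v, w, t, \<tau>)) \<in> SDP_feasible \<longleftrightarrow>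
    0 \<le> \<delta> \<and> 0 \<le> \<mu> \<and> 0 \<le> \<sigma> \<and> 0 \<le> \<nu> \<and> 0 \<le> \<pi> \<and>
    (\<forall>z. 0 \<le> quad_part u v w t z z) \<and> (\<forall>z. \<tau> \<le> lagrangian \<delta> \<mu> \<sigma> \<nu> \<pi> \<eta> \<zeta> u v w t z)"
proof -
  let ?q = "quad_part u v w t" and ?L = "lagrangian \<delta> \<mu> \<sigma> \<nu> \<pi> \<eta> \<zeta> u v w t"
  let ?l = "\<lambda>z. lin_part u v w t z + lagr_lin \<delta> \<mu> \<sigma> \<nu> \<pi> \<eta> \<zeta> z"
  let ?k = "const_part w t - \<eta> \<bullet> d - \<zeta> \<bullet> g - 1 \<bullet> \<pi>"
  have L: "?L z = ?q z z + ?l z + ?k" for z by (rule lagrangian_decompose)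
  have lin: "linear ?l" by (intro linear_compose_add linear_lin_part linear_lagr_lin)
  have form: "join4 x y s r \<bullet> (sdp_matrix \<delta> \<mu> \<sigma> \<nu> \<pi> \<eta> \<zeta> u v w t \<tau> *v join4 x y s r)
      = ?q (x, y, s) (x, y, s) + r * ?l (x, y, s) + r\<^sup>2 * (?k - \<tau>)" for x y s r
    by (rule quadratic_form_sdp_matrix)
  have "psd (sdp_matrix \<delta> \<mu> \<sigma> \<nu> \<pi> \<eta> \<zeta> u v w t \<tau>) \<longleftrightarrow>
      (\<forall>x y s r. 0 \<le> join4 x y s r \<bullet> (sdp_matrix \<delta> \<mu> \<sigma> \<nu> \<pi> \<eta> \<zeta> u v w t \<tau> *v join4 x y s r))"
    unfolding sdp_matrix_def
    by (rule psd_sym_block4_iff)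
      (simp_all add: P11_def P22_def P33_def transpose_add transpose_congruence_diag sym)
  also have "\<dots> \<longleftrightarrow> (\<forall>z r. 0 \<le> ?q z z + r * ?l z + r\<^sup>2 * (?k - \<tau>))"
    unfolding form by auto
  also have "\<dots> \<longleftrightarrow> (\<forall>z. 0 \<le> ?q z z) \<and> (\<forall>z. \<tau> \<le> ?L z)" (is "?lhs \<longleftrightarrow> ?rhs")
  proof
    assume *: ?lhs
    have "0 \<le> ?q z z" for z using *[rule_format, of z 0] by simp
    moreover have "\<tau> \<le> ?L z" for z using *[rule_format, of z 1] by (simp add: L)
    ultimately show ?rhs by blast
  next
    assume *: ?rhs
    show ?lhs
    proof (intro allI)
      fix z and r :: real
      show "0 \<le> ?q z z + r * ?l z + r\<^sup>2 * (?k - \<tau>)"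
      proof (cases "r = 0")
        case True
        then show ?thesis using * by (cases z) simp
      next
        case False
        let ?z = "(1 / r) *\<^sub>R z"
        have q: "?q z z = r\<^sup>2 * ?q ?z ?z"
          using False by (simp only: bilinear_lmul[OF bilinear_quad_part]
              bilinear_rmul[OF bilinear_quad_part]) (simp add: power2_eq_square)
        have l: "r * ?l z = r\<^sup>2 * ?l ?z"
          using False by (simp only: linear_scale[OF lin]) (simp add: power2_eq_square)
        have "?q z z + r * ?l z + r\<^sup>2 * (?k - \<tau>) = r\<^sup>2 * (?L ?z - \<tau>)"
          unfolding q l L by (simp only: distrib_left right_diff_distrib)
        moreover have "0 \<le> r\<^sup>2 * (?L ?z - \<tau>)" using *
          by (intro mult_nonneg_nonneg) (simp_all only: zero_le_power2 diff_ge_0_iff_ge)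
        ultimately show ?thesis by simp
      qed
    qed
  qed
  finally show ?thesis by (auto simp: SDP_feasible_def sdp_matrix_def)
qed

section \<open>Duality for the relaxation\<close>

text \<open>Weak duality: on the feasible set the equation terms vanish and the others are nonpositive.\<close>

lemma lagrangian_le_f:
  assumes "z \<in> relax_feasible" and "0 \<le> \<delta>" "0 \<le> \<mu>" "0 \<le> \<sigma>" "0 \<le> \<nu>" "0 \<le> \<pi>"
  shows "lagrangian \<delta> \<mu> \<sigma> \<nu> \<pi> \<eta> \<zeta> u v w t z \<le> f u v w t z"
proof -
  have nn: "0 \<le> p \<bullet> q" if "0 \<le> p" "0 \<le> q" for p q :: "real^'i"
    using that by (auto simp: inner_vec_def less_eq_vec_def intro!: sum_nonneg)
  obtain x y s where z: "z = (x, y, s)" by (cases z) auto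
  have "0 \<le> \<delta> \<bullet> s" "0 \<le> \<mu> \<bullet> (x - diag a *v y)" "0 \<le> \<sigma> \<bullet> (diag b *v y - x)"
    "0 \<le> \<nu> \<bullet> y" "0 \<le> \<pi> \<bullet> (1 - y)"
    using assms by (auto simp: z relax_feasible_def less_eq_vec_def intro!: nn)
  with assms(1) show ?thesis by (simp add: z lagrangian_def relax_feasible_def)
qed

text \<open>
  The constraints of the relaxation as families of affine functions over a finite index type, the
  form that strong duality expects. The summands of the index type of the inequalities correspond,
  from left to right, to the multipliers \<open>\<delta>, \<mu>, \<sigma>, \<nu>, \<pi>\<close>.
\<close>

definition ineq_lin :: "'m + 'n + 'n + 'n + 'n \<Rightarrow> (real^'n) \<times> (real^'n) \<times> (real^'m) \<Rightarrow> real" where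
  "ineq_lin = case_sum (\<lambda>j (x, y, s). s $ j) (case_sum (\<lambda>i (x, y, s). x $ i - a $ i * y $ i)
     (case_sum (\<lambda>i (x, y, s). b $ i * y $ i - x $ i)
     (case_sum (\<lambda>i (x, y, s). y $ i) (\<lambda>i (x, y, s). - y $ i))))"

definition ineq_const :: "'m + 'n + 'n + 'n + 'n \<Rightarrow> real" where
  "ineq_const = case_sum (\<lambda>_. 0) (case_sum (\<lambda>_. 0) (case_sum (\<lambda>_. 0) (case_sum (\<lambda>_. 0) (\<lambda>_. 1))))"

definition eq_lin :: "'m + 'k \<Rightarrow> (real^'n) \<times> (real^'n) \<times> (real^'m) \<Rightarrow> real" where
  "eq_lin = case_sum (\<lambda>j (x, y, s). (A *v x + B *v y + s) $ j) (\<lambda>k (x, y, s). (E *v x + F *v y) $ k)"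

definition eq_const :: "'m + 'k \<Rightarrow> real" where
  "eq_const = case_sum (\<lambda>j. - d $ j) (\<lambda>k. - g $ k)"

lemma linear_ineq_lin: "linear (ineq_lin i)"
  by (intro linearI) (auto simp: ineq_lin_def algebra_simps split: sum.split)

lemma linear_eq_lin: "linear (eq_lin j)"
  by (intro linearI)
    (auto simp: eq_lin_def matrix_vector_right_distrib matrix_vector_mult_scaleR algebra_simps
      split: sum.split)

lemma relax_feasible_iff:
  "z \<in> relax_feasible \<longleftrightarrow>
    (\<forall>i. 0 \<le> ineq_lin i z + ineq_const i) \<and> (\<forall>j. eq_lin j z + eq_const j = 0)"
  by (cases z) (auto simp: relax_feasible_def all_sum_iff ineq_lin_def ineq_const_def eq_lin_def
      eq_const_def less_eq_vec_def vec_eq_iff)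

text \<open>
  The bounds \<open>0 \<le> y \<le> 1\<close> confine \<open>x\<close> to a box, and \<open>s = d - A x - B y\<close> is a continuous function of
  \<open>(x, y)\<close>; so the feasible set is a closed part of the continuous image of a box.
\<close>

lemma compact_relax_feasible: "compact relax_feasible"
proof -
  have cont: "continuous_on UNIV (ineq_lin i)" "continuous_on UNIV (eq_lin j)" for i j
    using linear_ineq_lin linear_eq_lin by (auto intro: linear_continuous_on simp: linear_conv_bounded_linear)
  have "closed {z. (\<forall>i. 0 \<le> ineq_lin i z + ineq_const i) \<and> (\<forall>j. eq_lin j z + eq_const j = 0)}"
    by (intro closed_Collect_conj closed_Collect_all closed_Collect_le closed_Collect_eq
        continuous_intros cont)
  then have closed: "closed relax_feasible"
    by (simp flip: relax_feasible_iff)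
  let ?X = "cbox (\<chi> i. - max \<bar>a $ i\<bar> \<bar>b $ i\<bar>) (\<chi> i. max \<bar>a $ i\<bar> \<bar>b $ i\<bar>) \<times> cbox 0 (1 :: real^'n)"
  let ?g = "\<lambda>p. (fst p, snd p, d - A *v fst p - B *v snd p)"
  have image: "compact (?g ` ?X)"
    by (intro compact_continuous_image compact_Times compact_cbox continuous_intros
        linear_continuous_on_compose[OF _ matrix_vector_mul_linear])
  have "relax_feasible \<subseteq> ?g ` ?X"
  proof
    fix z assume z: "z \<in> relax_feasible"
    obtain x y s where xys: "z = (x, y, s)" by (cases z) auto
    have s: "A *v x + B *v y + s = d"
      and b: "a $ i * y $ i \<le> x $ i" "x $ i \<le> b $ i * y $ i" "0 \<le> y $ i" "y $ i \<le> 1" for i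
      using z by (auto simp: xys relax_feasible_def)
    have le: "\<bar>r * y $ i\<bar> \<le> \<bar>r\<bar>" for r i
      using b(3,4)[of i] by (simp add: abs_mult mult_left_le)
    have "- max \<bar>a $ i\<bar> \<bar>b $ i\<bar> \<le> x $ i \<and> x $ i \<le> max \<bar>a $ i\<bar> \<bar>b $ i\<bar>" for i
      using b(1,2)[of i] le[of "a $ i" i] le[of "b $ i" i] by linarith
    then have "(x, y) \<in> ?X" using b by (auto simp: mem_box_cart)
    moreover have "z = ?g (x, y)" using s by (auto simp: xys algebra_simps)
    ultimately show "z \<in> ?g ` ?X" by blast
  qed
  then have "?g ` ?X \<inter> relax_feasible = relax_feasible" by (rule Int_absorb1)
  with compact_Int_closed[OF image closed] show ?thesis by simp
qed

lemma continuous_f: "continuous_on S (f u v w t)"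
proof -
  have "continuous_on S (\<lambda>z. quad_part u v w t z z + lin_part u v w t z + const_part w t)"
    using bilinear_quad_part linear_lin_part
    by (intro continuous_intros bounded_bilinear.continuous_on[of "quad_part u v w t"]
        linear_continuous_on)
      (auto simp: bilinear_conv_bounded_bilinear linear_conv_bounded_linear)
  then show ?thesis by (simp add: f_decompose[abs_def])
qed

lemma MAX_feasible_iff:
  assumes "transpose Q = Q"
  shows "(u, v, w, t) \<in> MAX_feasible \<longleftrightarrow> (\<forall>z. 0 \<le> quad_part u v w t z z)"
  unfolding MAX_feasible_def f_decompose[abs_def] mem_Collect_eq prod.case
  by (intro convex_quadratic_iff bilinear_quad_part quad_part_commute linear_lin_part assms)

section \<open>Passing between the two problems\<close>

lemma SDP_feasible_imp_le_relax_value: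
  assumes sym: "transpose Q = Q"
    and feas: "((\<delta>, \<mu>, \<sigma>, \<nu>, \<pi>), (\<eta>, \<zeta>, u, v, w, t, \<tau>)) \<in> SDP_feasible"
  shows "(u, v, w, t) \<in> MAX_feasible" and "ereal \<tau> \<le> relax_value (u, v, w, t)"
proof -
  note * = feas[unfolded SDP_feasible_iff[OF sym]]
  show "(u, v, w, t) \<in> MAX_feasible" using * MAX_feasible_iff[OF sym] by blast
  have "\<tau> \<le> f u v w t z" if "z \<in> relax_feasible" for z
    using * lagrangian_le_f[OF that, of \<delta> \<mu> \<sigma> \<nu> \<pi> \<eta> \<zeta> u v w t] by (meson order_trans)
  then show "ereal \<tau> \<le> relax_value (u, v, w, t)"
    by (auto simp: relax_value_def min_value_def intro!: INF_greatest)
qed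

text \<open>
  Compactness provides a minimizer of the relaxation, strong duality the multipliers. The supremum
  over \<open>\<tau>\<close> is thus attained for each admissible \<open>(u, v, w, t)\<close>, which is what makes optimal parameters,
  and not only optimal values, correspond.
\<close>

lemma MAX_feasible_imp_SDP_attained:
  assumes sym: "transpose Q = Q" and ne: "relax_feasible \<noteq> {}"
    and feas: "(u, v, w, t) \<in> MAX_feasible"
  obtains \<delta> \<mu> \<sigma> \<nu> \<pi> \<eta> \<zeta> \<tau> where
    "((\<delta>, \<mu>, \<sigma>, \<nu>, \<pi>), (\<eta>, \<zeta>, u, v, w, t, \<tau>)) \<in> SDP_feasible"
    "relax_value (u, v, w, t) = ereal \<tau>"
proof -
  obtain z0 where z0: "z0 \<in> relax_feasible" "\<And>z. z \<in> relax_feasible \<Longrightarrow> f u v w t z0 \<le> f u v w t z"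
    using continuous_attains_inf[OF compact_relax_feasible ne continuous_f] by blast
  let ?\<tau> = "f u v w t z0"
  have psd: "0 \<le> quad_part u v w t z z" for z using feas MAX_feasible_iff[OF sym] by blast
  obtain \<xi> \<theta> where \<xi>: "\<And>i. 0 \<le> \<xi> i" and le: "\<And>z. ?\<tau> \<le> f u v w t z
      - (\<Sum>i\<in>UNIV. \<xi> i * (ineq_lin i z + ineq_const i)) + (\<Sum>j\<in>UNIV. \<theta> j * (eq_lin j z + eq_const j))"
  proof (rule convex_qp_strong_duality[of "quad_part u v w t" "lin_part u v w t" ineq_lin eq_lin
        "f u v w t" "const_part w t" z0 ineq_const eq_const])
  qed (use z0 relax_feasible_iff psd in \<open>auto intro: bilinear_quad_part quad_part_commute[OF sym]
        linear_lin_part linear_ineq_lin linear_eq_lin f_decompose\<close>)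
  define \<delta> \<mu> \<sigma> \<nu> \<pi> \<eta> \<zeta> where defs: "\<delta> = (\<chi> j. \<xi> (Inl j))" "\<mu> = (\<chi> i. \<xi> (Inr (Inl i)))"
    "\<sigma> = (\<chi> i. \<xi> (Inr (Inr (Inl i))))" "\<nu> = (\<chi> i. \<xi> (Inr (Inr (Inr (Inl i)))))"
    "\<pi> = (\<chi> i. \<xi> (Inr (Inr (Inr (Inr i)))))" "\<eta> = (\<chi> j. \<theta> (Inl j))" "\<zeta> = (\<chi> k. \<theta> (Inr k))"
  have "?\<tau> \<le> lagrangian \<delta> \<mu> \<sigma> \<nu> \<pi> \<eta> \<zeta> u v w t z" for z
  proof -
    obtain x y s where z: "z = (x, y, s)" by (cases z) auto
    have "(\<Sum>i\<in>UNIV. \<xi> i * (ineq_lin i z + ineq_const i)) = \<delta> \<bullet> s + \<mu> \<bullet> (x - diag a *v y)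
        + \<sigma> \<bullet> (diag b *v y - x) + \<nu> \<bullet> y + \<pi> \<bullet> (1 - y)"
      by (simp add: sum_over_sum_type ineq_lin_def ineq_const_def z defs inner_vec_def)
    moreover have "(\<Sum>j\<in>UNIV. \<theta> j * (eq_lin j z + eq_const j))
        = \<eta> \<bullet> (A *v x + B *v y + s - d) + \<zeta> \<bullet> (E *v x + F *v y - g)"
      by (simp add: sum_over_sum_type eq_lin_def eq_const_def z defs inner_vec_def)
    ultimately show ?thesis using le[of z] by (simp add: lagrangian_def z)
  qed
  then have "((\<delta>, \<mu>, \<sigma>, \<nu>, \<pi>), (\<eta>, \<zeta>, u, v, w, t, ?\<tau>)) \<in> SDP_feasible"
    unfolding SDP_feasible_iff[OF sym] using \<xi> psd by (auto simp: defs less_eq_vec_def)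
  moreover have "relax_value (u, v, w, t) = ereal ?\<tau>"
    unfolding relax_value_def min_value_def prod.case
    by (rule antisym) (use z0 in \<open>auto intro: INF_lower INF_greatest\<close>)
  ultimately show thesis by (rule that)
qed

text \<open>A feasible point of the mixed-integer problem, completed by its slack, is feasible for the relaxation.\<close>

lemma relax_feasible_nonempty:
  assumes "mip_feasible \<noteq> {}"
  shows "relax_feasible \<noteq> {}"
proof -
  obtain x y where xy: "(x, y) \<in> mip_feasible" using assms by auto
  have "(x, y, d - A *v x - B *v y) \<in> relax_feasible"
  proof -
    have *: "A *v x + B *v y \<le> d" "E *v x + F *v y = g"
      "a $ i * y $ i \<le> x $ i" "x $ i \<le> b $ i * y $ i" "y $ i = 0 \<or> y $ i = 1" for i
      using xy by (auto simp: mip_feasible_def)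
    have "0 \<le> y $ i \<and> y $ i \<le> 1" for i using *(5)[of i] by auto
    moreover have "0 \<le> d - A *v x - B *v y" using *(1) by (simp add: less_eq_vec_def algebra_simps)
    ultimately show ?thesis using *(2-4) by (simp add: relax_feasible_def)
  qed
  then show ?thesis by blast
qed

end

theorem theorem7:
  fixes Q :: "real^'n^'n"
    and c h :: "real^'n"
    and d :: "real^'m"
    and A B :: "real^'n^'m"
    and g :: "real^'k"
    and E F :: "real^'n^'k"
    and a b :: "real^'n"
  assumes "psd Q"
    and "\<And>i. a $ i < b $ i"
    and "mixed_binary_qp.mip_feasible d A B g E F a b \<noteq> {}"
  shows
    "max_value (mixed_binary_qp.relax_value Q c h d A B g E F a b)
         (mixed_binary_qp.MAX_feasible Q c h d A B g E F)
       = max_value mixed_binary_qp.SDP_objective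
         (mixed_binary_qp.SDP_feasible Q c h d A B g E F a b) \<and>
     (\<forall>u v w t.
       max_solution (mixed_binary_qp.relax_value Q c h d A B g E F a b)
         (mixed_binary_qp.MAX_feasible Q c h d A B g E F) (u, v, w, t) \<longleftrightarrow>
       (\<exists>\<delta> \<mu> \<sigma> \<nu> \<pi> \<eta> \<zeta> \<tau>.
         max_solution mixed_binary_qp.SDP_objective
           (mixed_binary_qp.SDP_feasible Q c h d A B g E F a b)
           ((\<delta>, \<mu>, \<sigma>, \<nu>, \<pi>), (\<eta>, \<zeta>, u, v, w, t, \<tau>))))"
proof -
  interpret mixed_binary_qp Q c h d A B g E F a b .
  have sym: "transpose Q = Q" using assms(1) by (simp add: psd_def)
  have ne: "relax_feasible \<noteq> {}" using assms(3) by (rule relax_feasible_nonempty)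
  have obj: "SDP_objective ((\<delta>, \<mu>, \<sigma>, \<nu>, \<pi>), (\<eta>, \<zeta>, u, v, w, t, \<tau>)) = ereal \<tau>"
    for \<delta> \<mu> \<sigma> \<nu> \<pi> \<eta> \<zeta> u v w t \<tau> by (simp add: SDP_objective_def)
  have to_SDP: "\<exists>\<delta> \<mu> \<sigma> \<nu> \<pi> \<eta> \<zeta> \<tau>. ((\<delta>, \<mu>, \<sigma>, \<nu>, \<pi>), (\<eta>, \<zeta>, u, v, w, t, \<tau>)) \<in> SDP_feasible
      \<and> relax_value (u, v, w, t) = ereal \<tau>" if "(u, v, w, t) \<in> MAX_feasible" for u v w t
    using MAX_feasible_imp_SDP_attained[OF sym ne that] by metis
  have "max_value relax_value MAX_feasible = max_value SDP_objective SDP_feasible"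
    unfolding max_value_def
  proof (rule antisym)
    show "(SUP p\<in>MAX_feasible. relax_value p) \<le> (SUP q\<in>SDP_feasible. SDP_objective q)"
    proof (rule SUP_mono)
      fix p assume p: "p \<in> MAX_feasible"
      obtain u v w t where "p = (u, v, w, t)" by (cases p) auto
      with to_SDP p obj show "\<exists>q\<in>SDP_feasible. relax_value p \<le> SDP_objective q"
        by (metis order_refl)
    qed
    show "(SUP q\<in>SDP_feasible. SDP_objective q) \<le> (SUP p\<in>MAX_feasible. relax_value p)"
    proof (rule SUP_mono)
      fix q assume q: "q \<in> SDP_feasible"
      obtain \<delta> \<mu> \<sigma> \<nu> \<pi> \<eta> \<zeta> u v w t \<tau> where "q = ((\<delta>, \<mu>, \<sigma>, \<nu>, \<pi>), (\<eta>, \<zeta>, u, v, w, t, \<tau>))"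
        by (metis surj_pair)
      with SDP_feasible_imp_le_relax_value[OF sym] q obj show "\<exists>p\<in>MAX_feasible. SDP_objective q \<le> relax_value p"
        by metis
    qed
  qed
  moreover have "max_solution relax_value MAX_feasible (u, v, w, t) \<longleftrightarrow>
      (\<exists>\<delta> \<mu> \<sigma> \<nu> \<pi> \<eta> \<zeta> \<tau>. max_solution SDP_objective SDP_feasible
        ((\<delta>, \<mu>, \<sigma>, \<nu>, \<pi>), (\<eta>, \<zeta>, u, v, w, t, \<tau>)))" (is "?max \<longleftrightarrow> ?sdp") for u v w t
  proof
    assume ?max
    then have feas: "(u, v, w, t) \<in> MAX_feasible"
      and opt: "\<And>p. p \<in> MAX_feasible \<Longrightarrow> relax_value p \<le> relax_value (u, v, w, t)"
      by (auto simp: max_solution_def is_arg_max_linorder)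
    obtain \<delta> \<mu> \<sigma> \<nu> \<pi> \<eta> \<zeta> \<tau> where
      *: "((\<delta>, \<mu>, \<sigma>, \<nu>, \<pi>), (\<eta>, \<zeta>, u, v, w, t, \<tau>)) \<in> SDP_feasible"
      "relax_value (u, v, w, t) = ereal \<tau>" using to_SDP[OF feas] by blast
    have "SDP_objective q \<le> ereal \<tau>" if q: "q \<in> SDP_feasible" for q
    proof -
      obtain \<delta>' \<mu>' \<sigma>' \<nu>' \<pi>' \<eta>' \<zeta>' u' v' w' t' \<tau>'
        where q': "q = ((\<delta>', \<mu>', \<sigma>', \<nu>', \<pi>'), (\<eta>', \<zeta>', u', v', w', t', \<tau>'))"
        by (metis surj_pair)
      note q = q[unfolded q']
      have "SDP_objective ((\<delta>', \<mu>', \<sigma>', \<nu>', \<pi>'), (\<eta>', \<zeta>', u', v', w', t', \<tau>'))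
          \<le> relax_value (u', v', w', t')"
        unfolding obj by (rule SDP_feasible_imp_le_relax_value(2)[OF sym q])
      also have "\<dots> \<le> relax_value (u, v, w, t)" by (rule opt[OF SDP_feasible_imp_le_relax_value(1)[OF sym q]])
      also have "\<dots> = ereal \<tau>" by (rule *(2))
      finally show ?thesis unfolding q' .
    qed
    with * have "max_solution SDP_objective SDP_feasible ((\<delta>, \<mu>, \<sigma>, \<nu>, \<pi>), (\<eta>, \<zeta>, u, v, w, t, \<tau>))"
      by (simp add: max_solution_def is_arg_max_linorder obj)
    then show ?sdp by blast
  next
    assume ?sdp
    then obtain \<delta> \<mu> \<sigma> \<nu> \<pi> \<eta> \<zeta> \<tau> where
      feas: "((\<delta>, \<mu>, \<sigma>, \<nu>, \<pi>), (\<eta>, \<zeta>, u, v, w, t, \<tau>)) \<in> SDP_feasible"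
      and opt: "\<And>q. q \<in> SDP_feasible \<Longrightarrow> SDP_objective q \<le> ereal \<tau>"
      by (auto simp: max_solution_def is_arg_max_linorder obj)
    have "relax_value p \<le> relax_value (u, v, w, t)" if p: "p \<in> MAX_feasible" for p
    proof -
      obtain u' v' w' t' where p': "p = (u', v', w', t')" by (cases p) auto
      have "relax_value p \<le> ereal \<tau>"
        using to_SDP[OF p[unfolded p']] opt unfolding p' by (metis obj)
      also have "\<dots> \<le> relax_value (u, v, w, t)" by (rule SDP_feasible_imp_le_relax_value(2)[OF sym feas])
      finally show ?thesis .
    qed
    with SDP_feasible_imp_le_relax_value(1)[OF sym feas] show ?max
      by (auto simp: max_solution_def is_arg_max_linorder)
  qed
  ultimately show ?thesis by blast
qed

end
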